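(* Let $A\in\mathbb{R}^{m\times n}$, $b\in\mathbb{R}^m$, $p\in(0,1]$, $\beta>0$, and let $\Lambda\in\mathbb{R}^{n\times n}$ be invertible. Let $\bar x$ be a global minimizer over $\mathbb{R}^n$ of $$J(x)=\tfrac12|Ax-b|_2^2+\beta|\Lambda x|_p^p,$$ and put $\bar y=\Lambda\bar x$, $\tilde A=A\Lambda^{-1}$, with $i$-th column $\tilde A_i$, and $$\mu_i=\beta^{\frac1{2-p}}(2-p)\,(2(1-p))^{-\frac{1-p}{2-p}}\,|\tilde A_i|_2^{\,1-\frac p{2-p}} .$$ Let $\lambda\in\mathbb{R}^n$ be the multiplier determined by $$A^*(A\bar x-b)+\Lambda^*\lambda=0 .$$ Then for every $i\in\{1,\dots,n\}$: (a) if $\big||\tilde A_i|_2^2\,\bar y_i+\lambda_i\big|<\mu_i$, then $(\Lambda\bar x)_i=0$; (b) if $\big||\tilde A_i|_2^2\,\bar y_i+\lambda_i\big|>\mu_i$, then $|(\Lambda\bar x)_i|>0$ and $\lambda_i=\dfrac{\beta p\,(\Lambda\bar x)_i}{|(\Lambda\bar x)_i|^{2-p}}$; (c) if $\big||\tilde A_i|_2^2\,\bar y_i+\lambda_i\big|=\mu_i$, then $(\Lambda\bar x)_i=0$ or $$(\Lambda\bar x)_i=\Big(\frac{2\beta(1-p)}{|\tilde A_i|_2^2}\Big)^{\frac1{2-p}}\operatorname{sgn}\big(|\tilde A_i|_2^2\,\bar y_i+\lambda_i\big).$$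
   Context: $|\cdot|_2$ is the Euclidean norm, $|y|_p^p=\sum_k|y_k|^p$, and $A^*,\Lambda^*$ denote transposes. For $p=1$ the convention $0^0=1$ is used in the formula for $\mu_i$. *)

theory Defs
  imports "HOL-Analysis.Analysis"
begin

text \<open>In the library \<^term>\<open>0 powr a = (0::real)\<close> holds for every \<open>a\<close>, including \<open>a = 0\<close>. The
  following power of a nonnegative base differs from \<^const>\<open>powr\<close> only in \<open>0\<^sup>0 = 1\<close>.\<close>

definition rpow :: "real \<Rightarrow> real \<Rightarrow> real" where
  "rpow x a = (if a = 0 then 1 else x powr a)"

text \<open>The quantity \<open>|y|\<^sub>p\<^sup>p\<close>; it is used for \<open>p > 0\<close> only, where a zero entry contributes \<open>0\<close>.\<close>

definition lp_pow :: "real \<Rightarrow> real ^ 'n \<Rightarrow> real" where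
  "lp_pow p y = (\<Sum>k\<in>UNIV. \<bar>y $ k\<bar> powr p)"

definition lp_functional ::
  "real ^ 'n ^ 'm \<Rightarrow> real ^ 'm \<Rightarrow> real \<Rightarrow> real \<Rightarrow> real ^ 'n ^ 'n \<Rightarrow> real ^ 'n \<Rightarrow> real" where
  "lp_functional A b p \<beta> \<Lambda> x = 1/2 * (norm (A *v x - b))\<^sup>2 + \<beta> * lp_pow p (\<Lambda> *v x)"

text \<open>Both \<^const>\<open>rpow\<close> factors have exponent \<open>0\<close> exactly when \<open>p = 1\<close>; then the threshold is \<open>\<beta>\<close>,
  also for a zero column.\<close>

definition threshold :: "real \<Rightarrow> real \<Rightarrow> real ^ 'm \<Rightarrow> real" where
  "threshold p \<beta> a =
     \<beta> powr (1 / (2 - p)) * (2 - p) * rpow (2 * (1 - p)) (- ((1 - p) / (2 - p)))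
       * rpow (norm a) (1 - p / (2 - p))"

end

theory Submission
  imports Defs
begin

text \<open>Restricting \<open>J\<close> to the lines \<open>\<Lambda>x = ybar + t e\<^sub>i\<close> shows that \<open>y = ybar\<^sub>i\<close> minimizes the scalar
  function \<open>h(s) = N s\<^sup>2 / 2 - c s + \<beta> |s|\<^sup>p\<close> with \<open>N = |At\<^sub>i|\<^sup>2\<close> and \<open>c = N y + \<lambda>\<^sub>i\<close>. For \<open>s = v sgn c\<close>
  with \<open>v > 0\<close> one has \<open>h(s) = v (g(v) - |c|)\<close>, where \<open>g(v) = N v / 2 + \<beta> v\<^sup>p\<^sup>-\<^sup>1\<close>. If \<open>p < 1\<close> and
  \<open>N > 0\<close>, then \<open>\<mu>\<^sub>i\<close> is the minimum of \<open>g\<close>, attained only at the value in (c); if \<open>p = 1\<close> it is the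
  unattained infimum. Comparing \<open>h(y)\<close> with \<open>h(0) = 0\<close> therefore decides whether \<open>y = 0\<close>, and for
  \<open>y \<noteq> 0\<close> the formula for \<open>\<lambda>\<^sub>i\<close> is the equation \<open>h'(y) = 0\<close>. If \<open>N = 0\<close>, then \<open>\<lambda>\<^sub>i = 0\<close> as well, so
  \<open>y = 0\<close>.\<close>

text \<open>The function \<open>g\<close> of the overview, rescaled so that its unique minimizer is
  \<open>t = 1\<close>. Strictness comes from \<open>ln t < t - 1\<close>, and the convexity bound
  for \<open>exp\<close> does the rest.\<close>

lemma add_powr_minus_gt:
  fixes t q :: real
  assumes "0 < t" "0 < q" "t \<noteq> 1"
  shows "1 + 1 / q < t + t powr (- q) / q"
proof -
  have "ln t < t - 1"
    using assms ln_le_minus_one[of t] ln_eq_minus_one[of t] by linarith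
  then have "1 - q * (t - 1) < 1 + - q * ln t"
    using assms by simp
  also have "\<dots> \<le> exp (- q * ln t)"
    by (rule exp_ge_add_one_self)
  also have "\<dots> = t powr (- q)"
    using assms by (simp add: powr_def)
  finally have "(1 + q) / q < (q * t + t powr (- q)) / q"
    using assms by (intro divide_strict_right_mono) (auto simp: algebra_simps)
  then show ?thesis
    using assms by (simp add: add_divide_distrib)
qed

lemma rpow_eq_powr: "a \<noteq> 0 \<Longrightarrow> rpow x a = x powr a"
  by (simp add: rpow_def)

text \<open>\<open>u\<close> is the critical point of \<open>g\<close>: \<open>g'(u) = 0\<close>
  says that \<open>u powr (2 - p)\<close> is the base in its definition. Multiplying this by
  \<open>u powr (p - 1)\<close> gives the second claim; the third identifies the threshold with
  \<open>g(u)\<close>.\<close>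

lemma threshold_eq:
  fixes a :: "real ^ 'm"
  assumes p: "0 < p" "p < 1" and \<beta>: "0 < \<beta>" and a: "a \<noteq> 0"
  defines "u \<equiv> (2 * \<beta> * (1 - p) / (norm a)\<^sup>2) powr (1 / (2 - p))"
  shows "0 < u"
    and "\<beta> * u powr (p - 1) = (norm a)\<^sup>2 * u / (2 * (1 - p))"
    and "threshold p \<beta> a = (norm a)\<^sup>2 * u / 2 + \<beta> * u powr (p - 1)"
proof -
  define n k e where "n = norm a" and "k = 2 * (1 - p)" and "e = 1 / (2 - p)"
  have n: "0 < n" and k: "0 < k" and e: "(2 - p) * e = 1"
    using a p by (auto simp: n_def k_def e_def)
  have u: "u = (\<beta> * k / n\<^sup>2) powr e"
    by (simp add: u_def n_def k_def e_def mult_ac)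
  show u0: "0 < u"
    using n k \<beta> by (simp add: u)
  have "u powr (2 - p) = \<beta> * k / n\<^sup>2"
    using n k \<beta> e by (simp add: u powr_powr mult.commute)
  moreover have "u = u powr (2 - p) * u powr (p - 1)"
    using u0 by (simp flip: powr_add)
  ultimately have *: "u = \<beta> * k / n\<^sup>2 * u powr (p - 1)"
    by simp
  have "n\<^sup>2 * u / k = n\<^sup>2 * (\<beta> * k / n\<^sup>2 * u powr (p - 1)) / k"
    by (subst *) (rule refl)
  then have **: "\<beta> * u powr (p - 1) = n\<^sup>2 * u / k"
    using n k by simp
  then show "\<beta> * u powr (p - 1) = (norm a)\<^sup>2 * u / (2 * (1 - p))"
    by (simp add: n_def k_def)
  \<comment> \<open>In terms of \<open>e\<close> the powers of \<beta>, \<open>k\<close> and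
    \<open>n\<close> collect into \<open>u\<close>, leaving the factor
    \<open>(2 - p) / k = 1/2 + 1/k\<close>.\<close>
  have ex: "- ((1 - p) / (2 - p)) = e - 1" "1 - p / (2 - p) = 2 - 2 * e"
    using p by (auto simp: e_def field_simps)
  have ne: "e - 1 \<noteq> 0" "2 - 2 * e \<noteq> 0"
    using p by (auto simp: e_def field_simps)
  have "threshold p \<beta> a = \<beta> powr e * (2 - p) * k powr (e - 1) * n powr (2 - 2 * e)"
    unfolding threshold_def ex rpow_eq_powr[OF ne(1)] rpow_eq_powr[OF ne(2)]
    by (simp add: n_def k_def e_def)
  also have "\<dots> = \<beta> powr e * k powr e / n powr (2 * e) * n powr 2 * ((2 - p) / k)"
    using k by (simp add: powr_diff mult_ac)
  also have "\<beta> powr e * k powr e / n powr (2 * e) = u"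
    using n k \<beta> by (simp add: u powr_divide powr_mult flip: powr_powr)
  also have "u * n powr 2 * ((2 - p) / k) = n\<^sup>2 * u / 2 + n\<^sup>2 * u / k"
    using n k by (simp add: k_def field_simps)
  finally show "threshold p \<beta> a = (norm a)\<^sup>2 * u / 2 + \<beta> * u powr (p - 1)"
    using ** by (simp add: n_def)
qed

text \<open>Substituting \<open>v = t * u\<close> makes \<open>g(v)\<close> a positive multiple of
  \<open>t + t powr (- q) / q\<close> with \<open>q = 1 - p\<close>, which is strictly minimal at
  \<open>t = 1\<close>.\<close>

lemma threshold_less:
  fixes a :: "real ^ 'm"
  assumes p: "0 < p" "p < 1" and \<beta>: "0 < \<beta>" and a: "a \<noteq> 0"
    and v: "0 < v" "v \<noteq> (2 * \<beta> * (1 - p) / (norm a)\<^sup>2) powr (1 / (2 - p))"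
  shows "threshold p \<beta> a < (norm a)\<^sup>2 * v / 2 + \<beta> * v powr (p - 1)"
proof -
  define u where "u = (2 * \<beta> * (1 - p) / (norm a)\<^sup>2) powr (1 / (2 - p))"
  note u = threshold_eq[OF p \<beta> a, folded u_def]
  define t where "t = v / u"
  have t: "0 < t" "t \<noteq> 1" "v = t * u"
    using v u(1) by (auto simp: t_def u_def)
  have "\<beta> * v powr (p - 1) = t powr (p - 1) * (\<beta> * u powr (p - 1))"
    using t u(1) by (simp add: powr_mult)
  then have "(norm a)\<^sup>2 * v / 2 + \<beta> * v powr (p - 1)
      = (norm a)\<^sup>2 * (t * u) / 2 + t powr (p - 1) * ((norm a)\<^sup>2 * u / (2 * (1 - p)))"
    using t(3) unfolding u(2) by simp
  also have "\<dots> = (norm a)\<^sup>2 * u / 2 * (t + t powr (- (1 - p)) / (1 - p))"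
    using p by (simp add: field_simps)
  finally have "(norm a)\<^sup>2 * v / 2 + \<beta> * v powr (p - 1)
      = (norm a)\<^sup>2 * u / 2 * (t + t powr (- (1 - p)) / (1 - p))" .
  moreover have "threshold p \<beta> a = (norm a)\<^sup>2 * u / 2 * (1 + 1 / (1 - p))"
    using p unfolding u(3) u(2) by (simp add: field_simps)
  moreover have "0 < (norm a)\<^sup>2 * u / 2"
    using a u(1) by simp
  moreover have "1 + 1 / (1 - p) < t + t powr (- (1 - p)) / (1 - p)"
    using t(1,2) p by (intro add_powr_minus_gt) auto
  ultimately show ?thesis
    by (metis mult_strict_left_mono)
qed

lemma threshold_one: "threshold 1 \<beta> a = \<beta>" if "0 < \<beta>"
  using that by (simp add: threshold_def rpow_def)

lemma threshold_nonneg: "0 \<le> threshold p \<beta> a" if "0 < p" "p \<le> 1" "0 < \<beta>"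
  using that by (simp add: threshold_def rpow_def)

text \<open>Supplies the competitor that beats \<open>s = 0\<close> in case (b). For
  \<open>p < 1\<close> the minimizer of \<open>g\<close> serves; for \<open>p = 1\<close> the
  infimum is not attained and a small \<open>v\<close> is needed.\<close>

lemma threshold_exceeded:
  fixes a :: "real ^ 'm"
  assumes p: "0 < p" "p \<le> 1" and \<beta>: "0 < \<beta>" and a: "a \<noteq> 0" and d: "threshold p \<beta> a < d"
  obtains v where "0 < v" "(norm a)\<^sup>2 * v / 2 + \<beta> * v powr (p - 1) < d"
proof (cases "p = 1")
  case True
  have "0 < (norm a)\<^sup>2" "\<beta> < d"
    using a d \<beta> True by (auto simp: threshold_one)
  then show ?thesis
    \<comment> \<open>Here \<open>N v / 2\<close> is half of the gap \<open>d - \<beta>\<close>, so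
      \<open>g(v) = (d + \<beta>) / 2\<close>.\<close>
    using True by (intro that[of "(d - \<beta>) / (norm a)\<^sup>2"]) (auto simp: field_simps)
next
  case False
  then have "p < 1"
    using p by simp
  note u = threshold_eq[OF p(1) this \<beta> a]
  show ?thesis
    using u(1) d unfolding u(3) by (rule that)
qed

text \<open>Differentiating along \<open>s = t * y\<close> at \<open>t = 1\<close> keeps the sign of
  \<open>s\<close>, so the penalty is a smooth power of \<open>t\<close> and no case distinction on
  the sign of \<open>y\<close> arises.\<close>

lemma scalar_stationary:
  fixes N c \<beta> p y :: real
  assumes y: "y \<noteq> 0"
    and min: "\<And>s. N * y\<^sup>2 / 2 - c * y + \<beta> * \<bar>y\<bar> powr p \<le> N * s\<^sup>2 / 2 - c * s + \<beta> * \<bar>s\<bar> powr p"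
  shows "c - N * y = \<beta> * p * y / \<bar>y\<bar> powr (2 - p)"
proof -
  define k where "k t = N * y\<^sup>2 / 2 * t\<^sup>2 - c * y * t + \<beta> * \<bar>y\<bar> powr p * t powr p" for t
  have "(k has_real_derivative (N * y\<^sup>2 - c * y + \<beta> * \<bar>y\<bar> powr p * p)) (at 1)"
    unfolding k_def by (auto intro!: derivative_eq_intros)
  moreover have "k 1 \<le> k t" if "\<bar>1 - t\<bar> < 1" for t
  proof -
    have "0 < t"
      using that by linarith
    then show ?thesis
      using min[of "t * y"] by (simp add: k_def abs_mult powr_mult power_mult_distrib mult_ac)
  qed
  ultimately have "N * y\<^sup>2 - c * y + \<beta> * \<bar>y\<bar> powr p * p = 0"
    by (intro DERIV_local_min[of k _ 1 1]) auto
  then have "(c - N * y) * y = \<beta> * p * \<bar>y\<bar> powr p"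
    by (simp add: algebra_simps power2_eq_square)
  also have "\<bar>y\<bar> powr p = y / \<bar>y\<bar> powr (2 - p) * y"
    using y by (simp add: powr_diff power2_eq_square)
  finally have "(c - N * y) * y = \<beta> * p * y / \<bar>y\<bar> powr (2 - p) * y"
    by simp
  then show ?thesis
    using y by (simp only: mult_cancel_right) simp
qed

lemma matrix_inv_right: "invertible M \<Longrightarrow> M ** matrix_inv M = mat 1"
  unfolding invertible_def matrix_inv_def by (rule someI2_ex) auto

text \<open>The direction \<open>z\<close> is mapped by \<Lambda> to the \<open>i\<close>-th unit
  vector and by \<open>A\<close> to the \<open>i\<close>-th column, so a single penalty term changes
  and the quadratic part expands exactly.\<close>

lemma lp_functional_line:
  fixes A :: "real ^ 'n ^ 'm" and \<Lambda> :: "real ^ 'n ^ 'n"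
  assumes "invertible \<Lambda>"
  shows "lp_functional A b p \<beta> \<Lambda> (x + t *\<^sub>R (matrix_inv \<Lambda> *v axis i 1)) - lp_functional A b p \<beta> \<Lambda> x
    = t * ((A *v x - b) \<bullet> column i (A ** matrix_inv \<Lambda>))
      + t\<^sup>2 * (norm (column i (A ** matrix_inv \<Lambda>)))\<^sup>2 / 2
      + \<beta> * (\<bar>(\<Lambda> *v x) $ i + t\<bar> powr p - \<bar>(\<Lambda> *v x) $ i\<bar> powr p)"
proof -
  define a r y where "a = column i (A ** matrix_inv \<Lambda>)" and "r = A *v x - b" and "y = \<Lambda> *v x"
  define z where "z = matrix_inv \<Lambda> *v axis i 1"
  have "\<Lambda> *v z = axis i 1"
    using matrix_inv_right[OF assms] by (simp add: z_def matrix_vector_mul_assoc)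
  then have Ly: "\<Lambda> *v (x + t *\<^sub>R z) = y + t *\<^sub>R axis i 1"
    by (simp add: y_def matrix_vector_right_distrib matrix_vector_mult_scaleR)
  have "A *v z = a"
    unfolding z_def a_def matrix_vector_mul_assoc by (rule matrix_vector_mult_basis)
  then have Ar: "A *v (x + t *\<^sub>R z) - b = r + t *\<^sub>R a"
    by (simp add: r_def matrix_vector_right_distrib matrix_vector_mult_scaleR)
  have "lp_pow p w = \<bar>w $ i\<bar> powr p + (\<Sum>k\<in>UNIV - {i}. \<bar>w $ k\<bar> powr p)" for w :: "real ^ 'n"
    unfolding lp_pow_def by (rule sum.remove) auto
  then have "lp_pow p (y + t *\<^sub>R axis i 1) - lp_pow p y = \<bar>y $ i + t\<bar> powr p - \<bar>y $ i\<bar> powr p"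
    by (simp add: axis_def)
  then have "\<beta> * lp_pow p (y + t *\<^sub>R axis i 1) - \<beta> * lp_pow p y
      = \<beta> * (\<bar>y $ i + t\<bar> powr p - \<bar>y $ i\<bar> powr p)"
    by (metis right_diff_distrib)
  moreover have "(norm (r + t *\<^sub>R a))\<^sup>2 = (norm r)\<^sup>2 + 2 * (t * (r \<bullet> a)) + t\<^sup>2 * (norm a)\<^sup>2"
    unfolding power2_norm_eq_inner
    by (simp add: algebra_simps inner_commute power2_eq_square)
  ultimately show ?thesis
    unfolding lp_functional_def Ly[unfolded z_def] Ar[unfolded z_def]
    by (simp add: add_divide_distrib flip: a_def r_def y_def)
qed

text \<open>Pair the multiplier equation with the same direction \<open>z\<close> and move the
  transposes across the inner product.\<close>

lemma multiplier_nth: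
  fixes A :: "real ^ 'n ^ 'm" and \<Lambda> :: "real ^ 'n ^ 'n"
  assumes "invertible \<Lambda>" and "transpose A *v r + transpose \<Lambda> *v lam = 0"
  shows "lam $ i = - (r \<bullet> column i (A ** matrix_inv \<Lambda>))"
proof -
  define z where "z = matrix_inv \<Lambda> *v axis i 1"
  have "\<Lambda> *v z = axis i 1"
    using matrix_inv_right[OF assms(1)] by (simp add: z_def matrix_vector_mul_assoc)
  then have "lam $ i = (transpose \<Lambda> *v lam) \<bullet> z"
    by (simp add: dot_lmul_matrix inner_axis)
  also have "transpose \<Lambda> *v lam = - (transpose A *v r)"
    using assms(2) by (simp add: eq_neg_iff_add_eq_0 add.commute)
  also have "- (transpose A *v r) \<bullet> z = - (r \<bullet> (A *v z))"
    by (simp add: dot_lmul_matrix)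
  also have "A *v z = column i (A ** matrix_inv \<Lambda>)"
    unfolding z_def matrix_vector_mul_assoc by (rule matrix_vector_mult_basis)
  finally show ?thesis .
qed

theorem theorem4p1:
  fixes A At :: "real ^ 'n ^ 'm" and b :: "real ^ 'm" and p \<beta> :: real
    and \<Lambda> :: "real ^ 'n ^ 'n" and xbar ybar lam :: "real ^ 'n" and \<mu> :: "'n \<Rightarrow> real" and i :: 'n
  assumes p: "0 < p" "p \<le> 1"
    and \<beta>: "0 < \<beta>"
    and \<Lambda>: "invertible \<Lambda>"
    and minimizer: "\<forall>x. lp_functional A b p \<beta> \<Lambda> xbar \<le> lp_functional A b p \<beta> \<Lambda> x"
    and ybar: "ybar = \<Lambda> *v xbar"
    and At: "At = A ** matrix_inv \<Lambda>"
    and \<mu>: "\<And>j. \<mu> j = threshold p \<beta> (column j At)"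
    and multiplier: "transpose A *v (A *v xbar - b) + transpose \<Lambda> *v lam = 0"
  shows "(\<bar>(norm (column i At))\<^sup>2 * ybar $ i + lam $ i\<bar> < \<mu> i \<longrightarrow> (\<Lambda> *v xbar) $ i = 0)
    \<and> (\<bar>(norm (column i At))\<^sup>2 * ybar $ i + lam $ i\<bar> > \<mu> i \<longrightarrow>
         \<bar>(\<Lambda> *v xbar) $ i\<bar> > 0
         \<and> lam $ i = \<beta> * p * (\<Lambda> *v xbar) $ i / \<bar>(\<Lambda> *v xbar) $ i\<bar> powr (2 - p))
    \<and> (\<bar>(norm (column i At))\<^sup>2 * ybar $ i + lam $ i\<bar> = \<mu> i \<longrightarrow>
         (\<Lambda> *v xbar) $ i = 0
         \<or> (\<Lambda> *v xbar) $ i =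
             (2 * \<beta> * (1 - p) / (norm (column i At))\<^sup>2) powr (1 / (2 - p))
             * sgn ((norm (column i At))\<^sup>2 * ybar $ i + lam $ i))"
proof -
  define a y c where "a = column i At" and "y = ybar $ i" and "c = (norm a)\<^sup>2 * y + lam $ i"
  have lam: "lam $ i = - ((A *v xbar - b) \<bullet> a)"
    using multiplier_nth[OF \<Lambda> multiplier] by (simp add: a_def At)
  \<comment> \<open>This is \<open>h(y) \<le> h(s)\<close>: a step of length \<open>s - y\<close>
    along the line, whose linear coefficient is \<open>- lam $ i = N y - c\<close>.\<close>
  have min: "(norm a)\<^sup>2 * y\<^sup>2 / 2 - c * y + \<beta> * \<bar>y\<bar> powr p
      \<le> (norm a)\<^sup>2 * s\<^sup>2 / 2 - c * s + \<beta> * \<bar>s\<bar> powr p" for s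
  proof -
    have "0 \<le> (s - y) * ((A *v xbar - b) \<bullet> a) + (s - y)\<^sup>2 * (norm a)\<^sup>2 / 2
        + \<beta> * (\<bar>s\<bar> powr p - \<bar>y\<bar> powr p)"
      using lp_functional_line[OF \<Lambda>, of A b p \<beta> xbar "s - y" i]
        minimizer[rule_format, of "xbar + (s - y) *\<^sub>R (matrix_inv \<Lambda> *v axis i 1)"]
      by (simp add: a_def y_def At flip: ybar)
    moreover have "(A *v xbar - b) \<bullet> a = (norm a)\<^sup>2 * y - c"
      by (simp add: c_def lam)
    ultimately show ?thesis
      by (simp add: field_simps power2_eq_square)
  qed
  \<comment> \<open>The comparison \<open>h(y) \<le> h(0) = 0\<close> divided by
    \<open>\<bar>y\<bar>\<close>; positivity of the left side then forces \<open>c\<close> and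
    \<open>y\<close> to have the same sign.\<close>
  have le: "y \<noteq> 0 \<Longrightarrow> (norm a)\<^sup>2 * \<bar>y\<bar> / 2 + \<beta> * \<bar>y\<bar> powr (p - 1) \<le> c * sgn y"
  proof -
    assume y: "y \<noteq> 0"
    have "((norm a)\<^sup>2 * \<bar>y\<bar> / 2 + \<beta> * \<bar>y\<bar> powr (p - 1)) * \<bar>y\<bar>
        = (norm a)\<^sup>2 * y\<^sup>2 / 2 + \<beta> * \<bar>y\<bar> powr p"
      using y by (simp add: powr_diff distrib_right power2_eq_square)
    also have "\<dots> \<le> c * sgn y * \<bar>y\<bar>"
      using min[of 0] by (simp add: mult.assoc sgn_mult_abs)
    finally show ?thesis
      using y by simp
  qed
  have sgn_c: "y \<noteq> 0 \<Longrightarrow> sgn c = sgn y \<and> c * sgn y = \<bar>c\<bar>"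
  proof -
    assume y: "y \<noteq> 0"
    have "0 < (norm a)\<^sup>2 * \<bar>y\<bar> / 2 + \<beta> * \<bar>y\<bar> powr (p - 1)"
      using y \<beta> by (intro add_nonneg_pos) auto
    then have "0 < c * sgn y"
      using le[OF y] by linarith
    then show ?thesis
      by (auto simp: sgn_if split: if_splits)
  qed
  have a0: "y = 0 \<and> c = 0" if "a = 0"
  proof -
    have "c = 0"
      using that lam by (simp add: c_def)
    then show ?thesis
      using min[of 0] that \<beta> by (auto simp: mult_le_0_iff)
  qed
  \<comment> \<open>By \<open>le\<close>, \<open>g(\<bar>y\<bar>) \<le> \<bar>c\<bar>\<close>, while
    \<open>g\<close> stays above the threshold except at its minimizer. The contrapositive of the
    first conjunct is (a); the second gives the modulus in (c), vacuously for
    \<open>p = 1\<close>.\<close>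
  have nonzero: "threshold p \<beta> a \<le> \<bar>c\<bar> \<and> (\<bar>c\<bar> = threshold p \<beta> a \<longrightarrow>
      \<bar>y\<bar> = (2 * \<beta> * (1 - p) / (norm a)\<^sup>2) powr (1 / (2 - p)))" if y: "y \<noteq> 0"
  proof -
    have a: "a \<noteq> 0"
      using a0 y by auto
    have c: "(norm a)\<^sup>2 * \<bar>y\<bar> / 2 + \<beta> * \<bar>y\<bar> powr (p - 1) \<le> \<bar>c\<bar>"
      using le[OF y] sgn_c[OF y] by simp
    show ?thesis
    proof (cases "p = 1")
      case True
      have "0 < (norm a)\<^sup>2 * \<bar>y\<bar> / 2"
        using a y by simp
      moreover have "\<bar>y\<bar> powr (p - 1) = 1"
        using y True by simp
      ultimately have "\<beta> < \<bar>c\<bar>"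
        using c by simp
      then show ?thesis
        using True \<beta> by (simp add: threshold_one)
    next
      case False
      then have p': "p < 1"
        using p by simp
      show ?thesis
        using threshold_less[OF p(1) p' \<beta> a, of "\<bar>y\<bar>"] threshold_eq(3)[OF p(1) p' \<beta> a] c y
        by fastforce
    qed
  qed
  have b: "y \<noteq> 0 \<and> lam $ i = \<beta> * p * y / \<bar>y\<bar> powr (2 - p)" if d: "threshold p \<beta> a < \<bar>c\<bar>"
  proof
    have a: "a \<noteq> 0"
      using a0 d threshold_nonneg[OF p \<beta>, of a] by auto
    obtain v where v: "0 < v" "(norm a)\<^sup>2 * v / 2 + \<beta> * v powr (p - 1) < \<bar>c\<bar>"
      using threshold_exceeded[OF p \<beta> a d] by blast
    show y: "y \<noteq> 0"
    \<comment> \<open>Otherwise \<open>s = v * sgn c\<close> would give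
      \<open>h(s) = v (g(v) - \<bar>c\<bar>) < 0 = h(y)\<close>.\<close>
    proof
      assume "y = 0"
      have c: "c \<noteq> 0"
        using d threshold_nonneg[OF p \<beta>, of a] by auto
      have "((norm a)\<^sup>2 * v / 2 + \<beta> * v powr (p - 1)) * v < \<bar>c\<bar> * v"
        using v by simp
      then have "(norm a)\<^sup>2 * v\<^sup>2 / 2 - \<bar>c\<bar> * v + \<beta> * v powr p < 0"
        using v by (simp add: powr_diff distrib_right power2_eq_square)
      moreover have "0 \<le> (norm a)\<^sup>2 * v\<^sup>2 / 2 - \<bar>c\<bar> * v + \<beta> * v powr p"
        using min[of "v * sgn c"] \<open>y = 0\<close> v c
        by (simp add: abs_mult power_mult_distrib abs_sgn mult_ac sgn_if split: if_splits)
      ultimately show False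
        by linarith
    qed
    show "lam $ i = \<beta> * p * y / \<bar>y\<bar> powr (2 - p)"
      using scalar_stationary[OF y min] by (simp add: c_def)
  qed
  \<comment> \<open>Restores the sign in (c), where so far only the modulus of \<open>y\<close> is
    known.\<close>
  have "y = \<bar>y\<bar> * sgn c" if "y \<noteq> 0"
    using sgn_c[OF that] by (metis mult.commute sgn_mult_abs)
  then show ?thesis
    using nonzero b unfolding \<mu> ybar[symmetric] a_def[symmetric] y_def[symmetric] c_def[symmetric]
    by (metis linorder_not_less zero_less_abs_iff)
qed

end
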